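(* Let $\mathbb{K}$ be an algebraically closed field of characteristic zero, let $\Gamma$ be a finite, simple, connected, undirected graph without loops with vertex set $V=\{1,\dots,n\}$, $n\ge 2$, and let $\mathcal{A}\in\{\mathcal{A}_\Gamma,\mathcal{A}_{RW(\Gamma)}\}$ be one of the two evolution $\mathbb{K}$-algebras associated to $\Gamma$. Then the rule $$\operatorname{Sym}(\Gamma)\times\operatorname{Aut}(\mathcal{A})\to\operatorname{Aut}(\mathcal{A}),\qquad (\sigma,f)\mapsto \sigma.f:=f_{\langle\sigma\rangle}$$ defines a free action of the group $\operatorname{Sym}(\Gamma)$ on the set $\operatorname{Aut}(\mathcal{A})$. Moreover, for every $f\in\operatorname{Aut}(\mathcal{A})$, the orbit $O_f=\{f_{\langle\sigma\rangle} : \sigma\in\operatorname{Sym}(\Gamma)\}$ has a group structure and it is isomorphic to $\operatorname{Sym}(\Gamma)$.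
   Context: For $i\in V$, $\mathcal{N}(i)=\{j\in V : \{i,j\}\text{ is an edge of }\Gamma\}$ and $d_i=|\mathcal{N}(i)|$. $\mathcal{A}_\Gamma$ is the $\mathbb{K}$-algebra with basis $B=\{e_1,\dots,e_n\}$ and bilinear product determined by $e_ie_j=0$ for $i\ne j$ and $e_i^2=\sum_{k\in\mathcal{N}(i)}e_k$. $\mathcal{A}_{RW(\Gamma)}$ is the $\mathbb{K}$-algebra with basis $B=\{e_1,\dots,e_n\}$ and bilinear product determined by $e_ie_j=0$ for $i\neq j$ and $e_i^2=\frac{1}{d_i}\sum_{k\in\mathcal{N}(i)}e_k$. $\operatorname{Aut}(\mathcal{A})$ is the group of bijective $\mathbb{K}$-linear maps $f:\mathcal{A}\to\mathcal{A}$ with $f(xy)=f(x)f(y)$ for all $x,y$. $\operatorname{Sym}(\Gamma)\le S_n$ is the group of permutations $\sigma$ of $V$ such that $i\in\mathcal{N}(j)$ if and only if $\sigma(i)\in\mathcal{N}(\sigma(j))$. For $f\in\operatorname{Aut}(\mathcal{A})$ with $f(e_i)=\sum_{k=1}^n t_{ik}e_k$ ($t_{ik}\in\mathbb{K}$) and $\sigma\in\operatorname{Sym}(\Gamma)$, $f_{\langle\sigma\rangle}$ denotes the linear map with $f_{\langle\sigma\rangle}(e_i)=\sum_{k=1}^n t_{ik}e_{\sigma(k)}$ for all $i$. *)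

theory Defs
  imports
    "HOL-Analysis.Cartesian_Space"
    "HOL-Computational_Algebra.Polynomial"
    "HOL-Algebra.Group_Action"
    "Graph_Theory.Digraph_Component"
begin

text \<open>
  An undirected simple graph is a \<^locale>\<open>pair_graph\<close>: a finite symmetric loop-free
  set of arcs, where the edge between \<open>i\<close> and \<open>j\<close> is the pair of arcs \<open>(i, j)\<close> and \<open>(j, i)\<close>.
\<close>

definition nbhd :: "'v pair_pre_digraph \<Rightarrow> 'v \<Rightarrow> 'v set" where
  "nbhd \<Gamma> i = {j \<in> pverts \<Gamma>. (i, j) \<in> parcs \<Gamma>}"

definition graph_sym :: "'v pair_pre_digraph \<Rightarrow> ('v \<Rightarrow> 'v) monoid" where
  "graph_sym \<Gamma> =
    \<lparr>carrier = {\<sigma>. \<sigma> permutes pverts \<Gamma> \<and>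
        (\<forall>i\<in>pverts \<Gamma>. \<forall>j\<in>pverts \<Gamma>. i \<in> nbhd \<Gamma> j \<longleftrightarrow> \<sigma> i \<in> nbhd \<Gamma> (\<sigma> j))},
     mult = (\<circ>), one = id\<rparr>"

text \<open>
  The algebras have underlying vector space \<open>'k ^ 'v\<close>, whose natural basis consists of the
  vectors \<open>axis i 1\<close>. An evolution algebra on this space is given by the squares \<open>s i\<close> of the
  basis vectors; the product below is the bilinear extension of \<open>e\<^sub>i e\<^sub>j = 0\<close> for \<open>i \<noteq> j\<close> and
  \<open>e\<^sub>i e\<^sub>i = s i\<close>.
\<close>

definition evolution_mult ::
    "('v \<Rightarrow> ('k::field) ^ 'v::finite) \<Rightarrow> 'k ^ 'v \<Rightarrow> 'k ^ 'v \<Rightarrow> 'k ^ 'v" where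
  "evolution_mult s x y =
    (\<Sum>i\<in>UNIV. \<Sum>j\<in>UNIV. (x $ i * y $ j) *s (if i = j then s i else 0))"

definition graph_mult ::
    "('v::finite) pair_pre_digraph \<Rightarrow> ('k::field) ^ 'v \<Rightarrow> 'k ^ 'v \<Rightarrow> 'k ^ 'v" where
  "graph_mult \<Gamma> = evolution_mult (\<lambda>i. \<Sum>k\<in>nbhd \<Gamma> i. axis k 1)"

definition rw_mult ::
    "('v::finite) pair_pre_digraph \<Rightarrow> ('k::field) ^ 'v \<Rightarrow> 'k ^ 'v \<Rightarrow> 'k ^ 'v" where
  "rw_mult \<Gamma> =
    evolution_mult (\<lambda>i. (1 / of_nat (card (nbhd \<Gamma> i))) *s (\<Sum>k\<in>nbhd \<Gamma> i. axis k 1))"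

definition alg_aut ::
    "(('k::field) ^ 'v::finite \<Rightarrow> 'k ^ 'v \<Rightarrow> 'k ^ 'v) \<Rightarrow> ('k ^ 'v \<Rightarrow> 'k ^ 'v) set" where
  "alg_aut m = {f. bij f \<and> Vector_Spaces.linear (*s) (*s) f \<and> (\<forall>x y. f (m x y) = m (f x) (f y))}"

text \<open>
  With \<open>t\<^sub>i\<^sub>k = f (axis i 1) $ k\<close>, this is the linear extension of
  \<open>e\<^sub>i \<mapsto> (\<Sum>k. t\<^sub>i\<^sub>k e\<^sub>\<sigma>\<^sub>(\<^sub>k\<^sub>))\<close>.
\<close>

definition twist ::
    "('v \<Rightarrow> 'v) \<Rightarrow> (('k::field) ^ 'v::finite \<Rightarrow> 'k ^ 'v) \<Rightarrow> 'k ^ 'v \<Rightarrow> 'k ^ 'v" where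
  "twist \<sigma> f x = (\<Sum>i\<in>UNIV. x $ i *s (\<Sum>k\<in>UNIV. f (axis i 1) $ k *s axis (\<sigma> k) 1))"

text \<open>
  \<^const>\<open>BijGroup\<close> requires functions that are extensional outside the set acted upon, hence
  the restriction to \<open>alg_aut m\<close>.
\<close>

definition twist_action ::
    "(('k::field) ^ 'v::finite \<Rightarrow> 'k ^ 'v \<Rightarrow> 'k ^ 'v) \<Rightarrow>
     ('v \<Rightarrow> 'v) \<Rightarrow> ('k ^ 'v \<Rightarrow> 'k ^ 'v) \<Rightarrow> ('k ^ 'v \<Rightarrow> 'k ^ 'v)" where
  "twist_action m \<sigma> = (\<lambda>f\<in>alg_aut m. twist \<sigma> f)"

locale free_group_action = group_action +
  assumes free: "\<And>g x. g \<in> carrier G \<Longrightarrow> x \<in> E \<Longrightarrow> \<phi> g x = x \<Longrightarrow> g = \<one>"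

end

theory Submission
  imports Defs
begin

text \<open>
  Twisting \<open>f\<close> by \<open>\<sigma>\<close> is composing it with the linear map \<open>P\<^sub>\<sigma>\<close> that permutes the natural basis,
  and \<open>P\<^sub>\<sigma>\<close> is an algebra automorphism because \<open>\<sigma>\<close> preserves neighbourhoods, hence also degrees.
  So the action is left multiplication by \<open>\<sigma> \<mapsto> P\<^sub>\<sigma>\<close>, an injective homomorphism into the group of
  automorphisms; it is free because \<open>f\<close> is surjective, and the group structure of an orbit is
  transported along the bijection \<open>\<sigma> \<mapsto> P\<^sub>\<sigma> \<circ> f\<close>.
\<close>

text \<open>The linear map with \<open>axis i 1\<close> sent to \<open>axis (\<sigma> i) 1\<close>
  for bijective \<open>\<sigma>\<close>, given by coordinates: coordinate \<open>j\<close> of the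
  image is the one that sat at the preimage of \<open>j\<close>, hence the inverse.\<close>

definition permute_basis :: "('v \<Rightarrow> 'v) \<Rightarrow> ('k::field) ^ 'v::finite \<Rightarrow> 'k ^ 'v" where
  "permute_basis \<sigma> x = (\<chi> j. x $ inv_into UNIV \<sigma> j)"

lemma permute_basis_nth [simp]: "permute_basis \<sigma> x $ j = x $ inv_into UNIV \<sigma> j"
  by (simp add: permute_basis_def)

lemma permute_basis_id: "permute_basis id = id"
  by (simp add: fun_eq_iff vec_eq_iff)

text \<open>Inversion reverses the order of composition and so does substitution into coordinates,
  so the two reversals cancel and the result is a left action.\<close>

lemma permute_basis_comp:
  assumes "bij \<sigma>" "bij \<tau>"
  shows "permute_basis (\<sigma> \<circ> \<tau>) = permute_basis \<sigma> \<circ> permute_basis \<tau>"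
  using assms by (simp add: fun_eq_iff vec_eq_iff o_inv_distrib)

lemma linear_permute_basis: "Vector_Spaces.linear (*s) (*s) (permute_basis \<sigma>)"
  by unfold_locales (auto simp: vec_eq_iff algebra_simps)

lemma bij_permute_basis:
  assumes "bij \<sigma>"
  shows "bij (permute_basis \<sigma> :: ('k::field) ^ 'v::finite \<Rightarrow> _)"
proof (rule o_bij)
  show "permute_basis (inv_into UNIV \<sigma>) \<circ> permute_basis \<sigma> = (id :: 'k ^ 'v \<Rightarrow> _)"
    using assms by (simp add: permute_basis_comp [symmetric] bij_imp_bij_inv bij_is_inj
        permute_basis_id)
  show "permute_basis \<sigma> \<circ> permute_basis (inv_into UNIV \<sigma>) = (id :: 'k ^ 'v \<Rightarrow> _)"
    using assms by (simp add: permute_basis_comp [symmetric] bij_imp_bij_inv bij_is_surj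
        surj_iff [THEN iffD1] permute_basis_id)
qed

text \<open>Faithfulness is tested on basis vectors: the image of \<open>axis i 1\<close> has
  coordinate 1 at \<open>\<sigma> i\<close>, whereas \<open>axis i 1\<close> itself is zero away
  from \<open>i\<close>.\<close>

lemma permute_basis_eq_idD:
  assumes "bij \<sigma>" and eq: "permute_basis \<sigma> = (id :: ('k::field) ^ 'v::finite \<Rightarrow> _)"
  shows "\<sigma> = id"
proof
  fix i
  have "permute_basis \<sigma> (axis i (1::'k)) $ \<sigma> i = 1"
    using assms(1) by (simp add: bij_is_inj)
  then have "axis i (1::'k) $ \<sigma> i = 1"
    by (simp add: eq)
  then show "\<sigma> i = id i"
    by (simp add: axis_def split: if_splits)
qed

text \<open>\<open>twist\<close> sees only the values of \<open>f\<close> on the natural basis;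
  linearity recovers \<open>f x\<close> from them.\<close>

lemma twist_eq_permute_basis:
  fixes f :: "('k::field) ^ 'v::finite \<Rightarrow> 'k ^ 'v"
  assumes "bij \<sigma>" and lin: "Vector_Spaces.linear (*s) (*s) f"
  shows "twist \<sigma> f = permute_basis \<sigma> \<circ> f"
proof
  fix x
  interpret Vector_Spaces.linear "(*s)" "(*s)" f by (fact lin)
  have "f x = f (\<Sum>i\<in>UNIV. x $ i *s axis i 1)"
    by (simp add: basis_expansion)
  also have "\<dots> = (\<Sum>i\<in>UNIV. x $ i *s f (axis i 1))"
    by (simp add: sum scale)
  finally have fx: "f x = (\<Sum>i\<in>UNIV. x $ i *s f (axis i 1))" .
  \<comment> \<open>Coordinate \<open>j\<close> of the inner sum in \<open>twist\<close> thus keeps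
    the single term with \<open>k\<close> the preimage of \<open>j\<close>.\<close>
  have "j = \<sigma> k \<longleftrightarrow> k = inv_into UNIV \<sigma> j" for j k
    using assms(1) by (metis bij_inv_eq_iff)
  then show "twist \<sigma> f x = (permute_basis \<sigma> \<circ> f) x"
    by (simp add: vec_eq_iff twist_def fx axis_def if_distrib cong: if_cong)
qed

lemma evolution_mult_nth:
  "evolution_mult s x y $ j = (\<Sum>i\<in>UNIV. x $ i * y $ i * s i $ j)"
  unfolding evolution_mult_def
  by (simp add: if_distrib [of "\<lambda>v. v $ j"] if_distrib [of "\<lambda>a. b * a" for b] cong: if_cong)

text \<open>The hypothesis on \<open>s\<close> says that the structure matrix is invariant under
  permuting rows and columns simultaneously. It moves \<open>\<sigma>\<close> from the column index
  to the row index, and reindexing the sum over rows by \<open>\<sigma>\<close> does the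
  rest.\<close>

lemma permute_basis_evolution_mult:
  assumes "bij \<sigma>" and s: "\<And>i j. s (\<sigma> i) $ \<sigma> j = s i $ j"
  shows "permute_basis \<sigma> (evolution_mult s x y)
    = evolution_mult s (permute_basis \<sigma> x) (permute_basis \<sigma> y)"
proof -
  have "(\<Sum>i\<in>UNIV. x $ i * y $ i * s i $ inv_into UNIV \<sigma> j)
      = (\<Sum>i\<in>UNIV. x $ inv_into UNIV \<sigma> i * y $ inv_into UNIV \<sigma> i * s i $ j)" for j
  proof -
    have "s i $ inv_into UNIV \<sigma> j = s (\<sigma> i) $ j" for i
      using s [of i "inv_into UNIV \<sigma> j"] assms(1) by (simp add: bij_is_surj surj_f_inv_f)
    then show ?thesis
      using assms(1) sum.reindex_bij_betw [OF assms(1),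
          of "\<lambda>i. x $ inv_into UNIV \<sigma> i * y $ inv_into UNIV \<sigma> i * s i $ j"]
      by (simp add: bij_is_inj)
  qed
  then show ?thesis
    by (simp add: vec_eq_iff evolution_mult_nth)
qed

lemma sum_axis_nth: "(\<Sum>k\<in>A. axis k (1::'k::field)) $ j = of_bool (j \<in> A)"
  for A :: "'v::finite set"
  by (simp add: axis_def if_distrib cong: if_cong)

lemma graph_symI:
  assumes "\<sigma> permutes pverts \<Gamma>"
    and "\<And>i j. i \<in> pverts \<Gamma> \<Longrightarrow> j \<in> pverts \<Gamma> \<Longrightarrow> i \<in> nbhd \<Gamma> j \<longleftrightarrow> \<sigma> i \<in> nbhd \<Gamma> (\<sigma> j)"
  shows "\<sigma> \<in> carrier (graph_sym \<Gamma>)"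
  using assms unfolding graph_sym_def partial_object.select_convs by blast

lemma graph_symD:
  assumes "\<sigma> \<in> carrier (graph_sym \<Gamma>)"
  shows "\<sigma> permutes pverts \<Gamma>"
    and "i \<in> pverts \<Gamma> \<Longrightarrow> j \<in> pverts \<Gamma> \<Longrightarrow> i \<in> nbhd \<Gamma> j \<longleftrightarrow> \<sigma> i \<in> nbhd \<Gamma> (\<sigma> j)"
  using assms unfolding graph_sym_def partial_object.select_convs by blast+

lemma mult_graph_sym: "\<sigma> \<otimes>\<^bsub>graph_sym \<Gamma>\<^esub> \<tau> = \<sigma> \<circ> \<tau>"
  by (simp add: graph_sym_def)

lemma permute_basis_in_alg_aut:
  fixes \<Gamma> :: "('v::finite) pair_pre_digraph"
    and m :: "('k::field) ^ 'v \<Rightarrow> 'k ^ 'v \<Rightarrow> 'k ^ 'v"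
  assumes verts: "pverts \<Gamma> = UNIV" and m: "m \<in> {graph_mult \<Gamma>, rw_mult \<Gamma>}"
    and \<sigma>: "\<sigma> \<in> carrier (graph_sym \<Gamma>)"
  shows "permute_basis \<sigma> \<in> alg_aut m"
proof -
  have bij: "bij \<sigma>" and nb: "\<And>i j. \<sigma> j \<in> nbhd \<Gamma> (\<sigma> i) \<longleftrightarrow> j \<in> nbhd \<Gamma> i"
    using graph_symD [OF \<sigma>] verts by (auto simp: permutes_bij)
  \<comment> \<open>Surjectivity of \<open>\<sigma>\<close> makes every neighbour of
    \<open>\<sigma> i\<close> an image; injectivity then gives equal degrees.\<close>
  have "nbhd \<Gamma> (\<sigma> i) = \<sigma> ` nbhd \<Gamma> i" for i
    using nb bij by (auto simp: image_iff) (metis bij_pointE)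
  then have "card (nbhd \<Gamma> (\<sigma> i)) = card (nbhd \<Gamma> i)" for i
    using bij by (simp add: card_image bij_is_inj inj_on_subset [OF _ subset_UNIV])
  \<comment> \<open>In both algebras the square of \<open>axis i 1\<close> is the indicator vector
    of \<open>nbhd \<Gamma> i\<close>, scaled by 1 or by the inverse degree, so its coordinates have
    the required invariance.\<close>
  then have "permute_basis \<sigma> (m x y) = m (permute_basis \<sigma> x) (permute_basis \<sigma> y)" for x y
    using m unfolding graph_mult_def rw_mult_def
    by (auto intro!: permute_basis_evolution_mult [OF bij]
        simp: nb sum_axis_nth simp del: sum_component)
  then show ?thesis
    by (simp add: alg_aut_def bij_permute_basis [OF bij] linear_permute_basis)
qed

lemma alg_aut_comp: "f \<in> alg_aut m \<Longrightarrow> g \<in> alg_aut m \<Longrightarrow> f \<circ> g \<in> alg_aut m"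
  by (auto simp: alg_aut_def bij_comp intro: Vector_Spaces.linear_compose)

lemma group_graph_sym: "group (graph_sym \<Gamma>)"
proof (rule groupI)
  fix \<sigma> \<tau> assume "\<sigma> \<in> carrier (graph_sym \<Gamma>)" "\<tau> \<in> carrier (graph_sym \<Gamma>)"
  note \<sigma> = graph_symD [OF this(1)] and \<tau> = graph_symD [OF this(2)]
  show "\<sigma> \<otimes>\<^bsub>graph_sym \<Gamma>\<^esub> \<tau> \<in> carrier (graph_sym \<Gamma>)"
    unfolding mult_graph_sym
  proof (rule graph_symI)
    show "\<sigma> \<circ> \<tau> permutes pverts \<Gamma>"
      by (rule permutes_compose [OF \<tau>(1) \<sigma>(1)])
    fix i j assume ij: "i \<in> pverts \<Gamma>" "j \<in> pverts \<Gamma>"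
    then have "\<tau> i \<in> pverts \<Gamma>" "\<tau> j \<in> pverts \<Gamma>"
      by (simp_all add: permutes_in_image [OF \<tau>(1)])
    then show "i \<in> nbhd \<Gamma> j \<longleftrightarrow> (\<sigma> \<circ> \<tau>) i \<in> nbhd \<Gamma> ((\<sigma> \<circ> \<tau>) j)"
      unfolding comp_apply using \<tau>(2) [OF ij] \<sigma>(2) by blast
  qed
next
  fix \<sigma> assume "\<sigma> \<in> carrier (graph_sym \<Gamma>)"
  note \<sigma> = graph_symD [OF this]
  let ?\<tau> = "inv_into UNIV \<sigma>"
  have "?\<tau> \<in> carrier (graph_sym \<Gamma>)"
  proof (rule graph_symI)
    show "?\<tau> permutes pverts \<Gamma>"
      by (rule permutes_inv [OF \<sigma>(1)])
    fix i j assume "i \<in> pverts \<Gamma>" "j \<in> pverts \<Gamma>"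
    then have "?\<tau> i \<in> pverts \<Gamma>" "?\<tau> j \<in> pverts \<Gamma>"
      by (simp_all add: permutes_in_image [OF permutes_inv [OF \<sigma>(1)]])
    \<comment> \<open>The adjacency condition for \<open>\<sigma>\<close> is applied to the
      preimages of \<open>i\<close> and \<open>j\<close>, where \<open>\<sigma>\<close> cancels its
      inverse.\<close>
    from \<sigma>(2) [OF this] show "i \<in> nbhd \<Gamma> j \<longleftrightarrow> ?\<tau> i \<in> nbhd \<Gamma> (?\<tau> j)"
      by (simp add: permutes_inverses [OF \<sigma>(1)])
  qed
  moreover have "?\<tau> \<otimes>\<^bsub>graph_sym \<Gamma>\<^esub> \<sigma> = \<one>\<^bsub>graph_sym \<Gamma>\<^esub>"
    by (simp add: graph_sym_def permutes_inv_o [OF \<sigma>(1)])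
  ultimately show "\<exists>\<tau>\<in>carrier (graph_sym \<Gamma>). \<tau> \<otimes>\<^bsub>graph_sym \<Gamma>\<^esub> \<sigma> = \<one>\<^bsub>graph_sym \<Gamma>\<^esub>"
    by blast
qed (simp_all add: graph_sym_def permutes_id o_assoc)

text \<open>Transport of structure: elements of the image are pulled back along \<open>h\<close>,
  multiplied in \<open>G\<close> and pushed forward, which makes \<open>h\<close> an isomorphism by
  construction.\<close>

lemma (in group) transported_group_iso:
  assumes "inj_on h (carrier G)"
  shows "\<exists>H :: 'c monoid. carrier H = h ` carrier G \<and> group H \<and> H \<cong> G"
proof -
  define g where "g = inv_into (carrier G) h"
  define H :: "'c monoid"
    where "H = \<lparr>carrier = h ` carrier G, mult = (\<lambda>a b. h (g a \<otimes> g b)), one = h \<one>\<rparr>"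
  have "h \<in> iso G H"
    using assms by (auto simp: iso_def hom_def bij_betw_def H_def g_def)
  \<comment> \<open>The general result gives a group whose unit is the image under \<open>h\<close>
    of the unit of \<open>G\<close>; this is the unit chosen for \<open>H\<close>.\<close>
  moreover have "group H"
    using iso_imp_img_group [OF \<open>h \<in> iso G H\<close>] by (simp add: H_def)
  ultimately show ?thesis
    by (intro exI [of _ H]) (auto simp: H_def is_iso_def dest: iso_set_sym)
qed

theorem theorem2p17:
  fixes \<Gamma> :: "('v::finite) pair_pre_digraph"
    and m :: "('k::{alg_closed_field, field_char_0}) ^ 'v \<Rightarrow> 'k ^ 'v \<Rightarrow> 'k ^ 'v"
  assumes "pair_graph \<Gamma>"
    and "pverts \<Gamma> = UNIV"
    and "CARD('v) \<ge> 2"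
    and "Digraph_Component.connected (with_proj \<Gamma>)"
    and "m \<in> {graph_mult \<Gamma>, rw_mult \<Gamma>}"
  shows "free_group_action (graph_sym \<Gamma>) (alg_aut m) (twist_action m) \<and>
    (\<forall>f \<in> alg_aut m. \<exists>H :: ('k ^ 'v \<Rightarrow> 'k ^ 'v) monoid.
       carrier H = {twist \<sigma> f | \<sigma>. \<sigma> \<in> carrier (graph_sym \<Gamma>)} \<and>
       group H \<and> H \<cong> graph_sym \<Gamma>)"
proof -
  let ?G = "graph_sym \<Gamma>"
  let ?P = "permute_basis :: _ \<Rightarrow> 'k ^ 'v \<Rightarrow> _"
  interpret G: group ?G by (rule group_graph_sym)
  have bij: "bij \<sigma>" if "\<sigma> \<in> carrier ?G" for \<sigma>
    using graph_symD(1) [OF that] by (rule permutes_bij)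
  have P_aut: "?P \<sigma> \<in> alg_aut m" if "\<sigma> \<in> carrier ?G" for \<sigma>
    using permute_basis_in_alg_aut that assms(2,5) by blast
  have twist: "twist \<sigma> f = ?P \<sigma> \<circ> f" if "\<sigma> \<in> carrier ?G" "f \<in> alg_aut m" for \<sigma> f
    using that by (intro twist_eq_permute_basis) (auto simp: bij alg_aut_def)
  have twist_aut: "twist \<sigma> f \<in> alg_aut m" if "\<sigma> \<in> carrier ?G" "f \<in> alg_aut m" for \<sigma> f
    using that by (simp add: twist P_aut alg_aut_comp)
  have twist_mult: "twist (\<sigma> \<otimes>\<^bsub>?G\<^esub> \<tau>) f = twist \<sigma> (twist \<tau> f)"
    if "\<sigma> \<in> carrier ?G" "\<tau> \<in> carrier ?G" "f \<in> alg_aut m" for \<sigma> \<tau> f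
    using that twist [OF G.m_closed [OF that(1,2)] that(3)]
    by (simp add: twist P_aut alg_aut_comp mult_graph_sym permute_basis_comp bij o_assoc)
  have twist_one: "twist \<one>\<^bsub>?G\<^esub> f = f" if "f \<in> alg_aut m" for f
    using twist [OF G.one_closed that] by (simp add: graph_sym_def permute_basis_id)
  have free: "\<sigma> = \<one>\<^bsub>?G\<^esub>"
    if \<sigma>: "\<sigma> \<in> carrier ?G" and f: "f \<in> alg_aut m" and eq: "twist \<sigma> f = f" for \<sigma> f
  proof -
    have "surj f"
      using f by (simp add: alg_aut_def bij_is_surj)
    \<comment> \<open>Every vector is some \<open>f x\<close>, and \<open>?P \<sigma>\<close> fixes
      all of these.\<close>
    then have "?P \<sigma> = id"
      using eq twist [OF \<sigma> f] by (metis comp_apply ext id_apply surjD)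
    then show ?thesis
      using permute_basis_eq_idD bij [OF \<sigma>] by (auto simp: graph_sym_def)
  qed
  have twist_inv: "twist (inv\<^bsub>?G\<^esub> \<sigma>) (twist \<sigma> f) = f" "twist \<sigma> (twist (inv\<^bsub>?G\<^esub> \<sigma>) f) = f"
    if "\<sigma> \<in> carrier ?G" "f \<in> alg_aut m" for \<sigma> f
    using that by (simp_all flip: twist_mult add: twist_one)
  have action_Bij: "twist_action m \<sigma> \<in> Bij (alg_aut m)" if \<sigma>: "\<sigma> \<in> carrier ?G" for \<sigma>
  proof -
    have "bij_betw (twist \<sigma>) (alg_aut m) (alg_aut m)"
      using \<sigma> by (intro bij_betw_byWitness [where f' = "twist (inv\<^bsub>?G\<^esub> \<sigma>)"])
        (auto simp: twist_inv twist_aut)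
    then have "bij_betw (twist_action m \<sigma>) (alg_aut m) (alg_aut m)"
      by (rule bij_betw_cong [THEN iffD1, rotated]) (simp add: twist_action_def)
    then show ?thesis
      by (simp add: Bij_def twist_action_def)
  qed
  have "twist_action m \<in> hom ?G (BijGroup (alg_aut m))"
  proof (rule homI)
    fix \<sigma> \<tau> assume "\<sigma> \<in> carrier ?G" "\<tau> \<in> carrier ?G"
    \<comment> \<open>The product in \<open>BijGroup\<close> is composition restricted to
      \<open>alg_aut m\<close>; by \<open>twist_aut\<close> the inner value stays in that set, so
      the restrictions do no harm and \<open>twist_mult\<close> applies.\<close>
    then show "twist_action m (\<sigma> \<otimes>\<^bsub>?G\<^esub> \<tau>)
        = twist_action m \<sigma> \<otimes>\<^bsub>BijGroup (alg_aut m)\<^esub> twist_action m \<tau>"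
      using action_Bij
      by (auto simp: BijGroup_def twist_action_def fun_eq_iff compose_def restrict_def
          twist_mult twist_aut)
  qed (simp add: BijGroup_def action_Bij)
  then have "free_group_action ?G (alg_aut m) (twist_action m)"
    using free by (intro free_group_action.intro group_action.intro group_hom.intro
        group_hom_axioms.intro free_group_action_axioms.intro group_graph_sym group_BijGroup)
      (simp_all add: twist_action_def)
  moreover have "\<exists>H :: ('k ^ 'v \<Rightarrow> 'k ^ 'v) monoid.
      carrier H = {twist \<sigma> f | \<sigma>. \<sigma> \<in> carrier ?G} \<and> group H \<and> H \<cong> ?G"
    if f: "f \<in> alg_aut m" for f
  proof -
    \<comment> \<open>Injectivity of the orbit map is freeness: if two twists of \<open>f\<close>
      agree, the quotient of the two permutations fixes \<open>f\<close>.\<close>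
    have "inj_on (\<lambda>\<sigma>. twist \<sigma> f) (carrier ?G)"
    proof (rule inj_onI)
      fix \<sigma> \<tau> assume *: "\<sigma> \<in> carrier ?G" "\<tau> \<in> carrier ?G" "twist \<sigma> f = twist \<tau> f"
      then have "twist (inv\<^bsub>?G\<^esub> \<tau> \<otimes>\<^bsub>?G\<^esub> \<sigma>) f = f"
        using f by (simp add: twist_mult twist_inv)
      then have "inv\<^bsub>?G\<^esub> \<tau> \<otimes>\<^bsub>?G\<^esub> \<sigma> = \<one>\<^bsub>?G\<^esub>"
        using free f * by simp
      then show "\<sigma> = \<tau>"
        using * by (metis G.inv_closed G.inv_equality G.inv_inv)
    qed
    \<comment> \<open>The product on the orbit is that of \<open>?G\<close> read through
      \<open>\<sigma> \<mapsto> twist \<sigma> f\<close>, with \<open>f\<close> as unit; it is not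
      defined as composition of automorphisms.\<close>
    from G.transported_group_iso [OF this] show ?thesis
      by (simp add: image_def Setcompr_eq_image)
  qed
  ultimately show ?thesis
    by blast
qed

end
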